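(* Let $\{V_n\}_{n\ge 0}$ be a generalized Tribonacci sequence with parameters $r,s,t$, let $\{O_{v,n}\}_{n\ge 0}$ be the associated generalized Tribonacci octonions, and let $\{U_n\}_{n\ge 0}$ be the sequence with $U_0=0$, $U_1=1$, $U_2=r$ and $U_n=rU_{n-1}+sU_{n-2}+tU_{n-3}$ for $n\ge 3$. Then for all integers $n\geq 0$ and $m\geq 3$, $$O_{v,n+m}=U_{m-1}O_{v,n+2}+(sU_{m-2}+tU_{m-3})O_{v,n+1}+tU_{m-2}O_{v,n}.$$
   Context: Generalized Tribonacci sequence: $r,s,t$ are real numbers, $V_0,V_1,V_2$ are arbitrary integers, and $V_n=rV_{n-1}+sV_{n-2}+tV_{n-3}$ for $n\ge 3$. Standing assumption: $\Delta=\frac{r^{3}t}{27}-\frac{r^{2}s^{2}}{108}+\frac{rst}{6}-\frac{s^{3}}{27}+\frac{t^{2}}{4}>0$, so that $x^3-rx^2-sx-t=0$ has one real root and two nonreal complex conjugate roots. Octonions: $\mathbb{O}$ is the real octonion algebra, an $8$-dimensional real vector space with basis $e_0=\mathbf{1},e_1,\dots,e_7$. The $n$-th generalized Tribonacci octonion is $O_{v,n}=\sum_{l=0}^{7}V_{n+l}e_l=V_n+\sum_{l=1}^{7}V_{n+l}e_l$, $n\ge 0$. *)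

theory Defs
  imports "HOL-Analysis.Analysis"
begin

datatype octonion =
  Oct (oct0: real) (oct1: real) (oct2: real) (oct3: real) (oct4: real) (oct5: real) (oct6: real) (oct7: real)

lemma octonion_eq_iff:
  "x = y \<longleftrightarrow>
     oct0 x = oct0 y \<and> oct1 x = oct1 y \<and> oct2 x = oct2 y \<and> oct3 x = oct3 y \<and>
     oct4 x = oct4 y \<and> oct5 x = oct5 y \<and> oct6 x = oct6 y \<and> oct7 x = oct7 y"
  by (cases x; cases y) simp

instantiation octonion :: real_vector
begin

definition "0 = Oct 0 0 0 0 0 0 0 0"

definition
  "x + y = Oct
       (oct0 x + oct0 y) (oct1 x + oct1 y) (oct2 x + oct2 y) (oct3 x + oct3 y)
       (oct4 x + oct4 y) (oct5 x + oct5 y) (oct6 x + oct6 y) (oct7 x + oct7 y)"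

definition
  "x - y = Oct
       (oct0 x - oct0 y) (oct1 x - oct1 y) (oct2 x - oct2 y) (oct3 x - oct3 y)
       (oct4 x - oct4 y) (oct5 x - oct5 y) (oct6 x - oct6 y) (oct7 x - oct7 y)"

definition
  "- x = Oct
       (- oct0 x) (- oct1 x) (- oct2 x) (- oct3 x)
       (- oct4 x) (- oct5 x) (- oct6 x) (- oct7 x)"

definition
  "a *\<^sub>R x = Oct
       (a * oct0 x) (a * oct1 x) (a * oct2 x) (a * oct3 x)
       (a * oct4 x) (a * oct5 x) (a * oct6 x) (a * oct7 x)"

instance
  by standard
     (simp_all add: octonion_eq_iff zero_octonion_def plus_octonion_def minus_octonion_def
        uminus_octonion_def scaleR_octonion_def algebra_simps)

end

text \<open>
  Multiplication is the Cayley--Dickson product of pairs of quaternions,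
  (a, b) (c, d) = (a c - d* b, d a + b c*), where * is conjugation,
  (a, b) = a + b e, and the basis is 1, i, j, k, e, i e, j e, k e.
  It is not associative, so the library's classes for real algebras do not apply
  and of_real is not available: the real number x is embedded as x *_R 1.
\<close>

instantiation octonion :: "{one, times}"
begin

definition "1 = Oct 1 0 0 0 0 0 0 0"

definition
  "x * y = Oct
       (oct0 x * oct0 y - oct1 x * oct1 y - oct2 x * oct2 y - oct3 x * oct3 y
        - oct4 x * oct4 y - oct5 x * oct5 y - oct6 x * oct6 y - oct7 x * oct7 y)
       (oct0 x * oct1 y + oct1 x * oct0 y + oct2 x * oct3 y - oct3 x * oct2 y
        + oct4 x * oct5 y - oct5 x * oct4 y - oct6 x * oct7 y + oct7 x * oct6 y)
       (oct0 x * oct2 y - oct1 x * oct3 y + oct2 x * oct0 y + oct3 x * oct1 y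
        + oct4 x * oct6 y + oct5 x * oct7 y - oct6 x * oct4 y - oct7 x * oct5 y)
       (oct0 x * oct3 y + oct1 x * oct2 y - oct2 x * oct1 y + oct3 x * oct0 y
        + oct4 x * oct7 y - oct5 x * oct6 y + oct6 x * oct5 y - oct7 x * oct4 y)
       (oct0 x * oct4 y - oct1 x * oct5 y - oct2 x * oct6 y - oct3 x * oct7 y
        + oct4 x * oct0 y + oct5 x * oct1 y + oct6 x * oct2 y + oct7 x * oct3 y)
       (oct0 x * oct5 y + oct1 x * oct4 y - oct2 x * oct7 y + oct3 x * oct6 y
        - oct4 x * oct1 y + oct5 x * oct0 y - oct6 x * oct3 y + oct7 x * oct2 y)
       (oct0 x * oct6 y + oct1 x * oct7 y + oct2 x * oct4 y - oct3 x * oct5 y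
        - oct4 x * oct2 y + oct5 x * oct3 y + oct6 x * oct0 y - oct7 x * oct1 y)
       (oct0 x * oct7 y - oct1 x * oct6 y + oct2 x * oct5 y + oct3 x * oct4 y
        - oct4 x * oct3 y - oct5 x * oct2 y + oct6 x * oct1 y + oct7 x * oct0 y)"

instance ..

end

definition octonion_basis :: "nat \<Rightarrow> octonion" where
  "octonion_basis l = Oct
       (of_bool (l = 0)) (of_bool (l = 1)) (of_bool (l = 2)) (of_bool (l = 3))
       (of_bool (l = 4)) (of_bool (l = 5)) (of_bool (l = 6)) (of_bool (l = 7))"

lemma octonion_basis_0: "octonion_basis 0 = 1"
  by (simp add: octonion_basis_def one_octonion_def)

lemma octonion_basis_expansion:
  "(\<Sum>l\<le>7. c l *\<^sub>R octonion_basis l) = Oct (c 0) (c 1) (c 2) (c 3) (c 4) (c 5) (c 6) (c 7)"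
  by (simp add: octonion_eq_iff octonion_basis_def zero_octonion_def plus_octonion_def
        scaleR_octonion_def eval_nat_numeral)

text \<open>
  The product is bilinear and unital and admits composition for the sum of squares of the
  coordinates, which determines the octonions among the eight-dimensional real algebras.
\<close>

lemma octonion_mult_one:
  fixes x :: octonion
  shows "1 * x = x" "x * 1 = x"
  by (simp_all add: octonion_eq_iff one_octonion_def times_octonion_def)

lemma octonion_mult_bilinear:
  fixes x y z :: octonion
  shows "(x + y) * z = x * z + y * z" "x * (y + z) = x * y + x * z"
    "(a *\<^sub>R x) * y = a *\<^sub>R (x * y)" "x * (a *\<^sub>R y) = a *\<^sub>R (x * y)"
  by (simp_all add: octonion_eq_iff times_octonion_def plus_octonion_def scaleR_octonion_def
        algebra_simps)

definition octonion_normsq :: "octonion \<Rightarrow> real" where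
  "octonion_normsq x =
     (oct0 x)\<^sup>2 + (oct1 x)\<^sup>2 + (oct2 x)\<^sup>2 + (oct3 x)\<^sup>2 + (oct4 x)\<^sup>2 + (oct5 x)\<^sup>2 + (oct6 x)\<^sup>2 + (oct7 x)\<^sup>2"

lemma octonion_normsq_mult: "octonion_normsq (x * y) = octonion_normsq x * octonion_normsq y"
  unfolding octonion_normsq_def times_octonion_def octonion.sel by algebra

definition tribonacci_recurrence :: "real \<Rightarrow> real \<Rightarrow> real \<Rightarrow> (nat \<Rightarrow> real) \<Rightarrow> bool" where
  "tribonacci_recurrence r s t W \<longleftrightarrow>
     (\<forall>n\<ge>3. W n = r * W (n - 1) + s * W (n - 2) + t * W (n - 3))"

text \<open>
  Only the three initial values are integers; the later terms are merely real,
  because r, s, t are.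
\<close>

definition generalized_tribonacci ::
    "real \<Rightarrow> real \<Rightarrow> real \<Rightarrow> (nat \<Rightarrow> real) \<Rightarrow> bool" where
  "generalized_tribonacci r s t V \<longleftrightarrow>
     V 0 \<in> \<int> \<and> V 1 \<in> \<int> \<and> V 2 \<in> \<int> \<and> tribonacci_recurrence r s t V"

text \<open>
  Multiplied by -108 this is the discriminant of x^3 - r x^2 - s x - t, so it is positive
  iff that cubic has one real root and two nonreal conjugate roots.
\<close>

definition tribonacci_discriminant :: "real \<Rightarrow> real \<Rightarrow> real \<Rightarrow> real" where
  "tribonacci_discriminant r s t =
     r ^ 3 * t / 27 - r\<^sup>2 * s\<^sup>2 / 108 + r * s * t / 6 - s ^ 3 / 27 + t\<^sup>2 / 4"

definition tribonacci_octonion :: "(nat \<Rightarrow> real) \<Rightarrow> nat \<Rightarrow> octonion" where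
  "tribonacci_octonion V n = (\<Sum>l\<le>7. V (n + l) *\<^sub>R octonion_basis l)"

end

theory Submission
  imports Defs
begin

text \<open>
  The octonion \<open>tribonacci_octonion V n\<close> is built linearly from the shifts of \<open>V\<close>, so the
  octonion sequence obeys the same third-order recurrence as \<open>V\<close>
  (\<open>tribonacci_octonion_recurrence\<close>). It therefore
  suffices to prove the identity for a solution \<open>W\<close> of the recurrence in a real vector space
  (\<open>tribonacci_shift_formula\<close>).

  There, \<open>W (n + m)\<close> is a combination of \<open>W (n + 2)\<close>, \<open>W (n + 1)\<close>, \<open>W n\<close> with coefficients
  independent of the base point \<open>n\<close>. To raise \<open>m\<close> by one, move the base point to \<open>n + 1\<close> and
  eliminate \<open>W (n + 3)\<close> by the recurrence. The new coefficient of \<open>W (n + 2)\<close> is then \<open>r\<close> times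
  its old value plus the old coefficient of \<open>W (n + 1)\<close>, that is,
  \<open>r U\<^sub>m\<^sub>-\<^sub>1 + s U\<^sub>m\<^sub>-\<^sub>2 + t U\<^sub>m\<^sub>-\<^sub>3 = U\<^sub>m\<close>. This is why the solution \<open>U\<close> with initial values
  \<open>0, 1, r\<close> supplies the coefficients.
\<close>

lemma tribonacci_recurrence_step:
  assumes "tribonacci_recurrence r s t W"
  shows "W (n + 3) = r * W (n + 2) + s * W (n + 1) + t * W n"
  using assms[unfolded tribonacci_recurrence_def, rule_format, of "n + 3"] by simp

text \<open>
  The induction runs on the distance \<open>k\<close> with the base point \<open>n\<close> arbitrary, because the
  induction hypothesis is applied at \<open>n + 1\<close>.
\<close>

lemma tribonacci_shift_formula:
  fixes W :: "nat \<Rightarrow> 'a::real_vector" and U :: "nat \<Rightarrow> real"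
  assumes W: "\<And>n. W (n + 3) = r *\<^sub>R W (n + 2) + s *\<^sub>R W (n + 1) + t *\<^sub>R W n"
    and U: "tribonacci_recurrence r s t U" "U 0 = 0" "U 1 = 1" "U 2 = r"
  shows "W (n + (k + 3)) =
           U (k + 2) *\<^sub>R W (n + 2) + (s * U (k + 1) + t * U k) *\<^sub>R W (n + 1)
           + (t * U (k + 1)) *\<^sub>R W n"
proof (induction k arbitrary: n)
  case 0
  show ?case
    using W[of n] U by (simp add: numeral_2_eq_2)
next
  case (Suc k)
  have "W (n + (Suc k + 3)) = W ((n + 1) + (k + 3))"
    by (rule arg_cong[where f = W]) simp
  also have "\<dots> = U (k + 2) *\<^sub>R W (n + 3) + (s * U (k + 1) + t * U k) *\<^sub>R W (n + 2)
                  + (t * U (k + 1)) *\<^sub>R W (n + 1)"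
    using Suc.IH[of "n + 1"] by (simp add: eval_nat_numeral)
  also have "\<dots> = (r * U (k + 2) + s * U (k + 1) + t * U k) *\<^sub>R W (n + 2)
                  + (s * U (k + 2) + t * U (k + 1)) *\<^sub>R W (n + 1) + (t * U (k + 2)) *\<^sub>R W n"
    unfolding W[of n] by (simp add: algebra_simps)
  also have "r * U (k + 2) + s * U (k + 1) + t * U k = U (k + 3)"
    using tribonacci_recurrence_step[OF U(1), of k] by simp
  finally show ?case
    by (simp add: eval_nat_numeral)
qed

lemma tribonacci_octonion_recurrence:
  assumes "tribonacci_recurrence r s t V"
  shows "tribonacci_octonion V (n + 3) =
           r *\<^sub>R tribonacci_octonion V (n + 2) + s *\<^sub>R tribonacci_octonion V (n + 1)
           + t *\<^sub>R tribonacci_octonion V n"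
proof -
  have "V (n + 3 + l) = r * V (n + 2 + l) + s * V (n + 1 + l) + t * V (n + l)" for l
    using tribonacci_recurrence_step[OF assms, of "n + l"] by (simp add: ac_simps)
  then show ?thesis
    unfolding tribonacci_octonion_def
    by (simp add: scaleR_add_left sum.distrib scaleR_sum_right)
qed

theorem theorem3p5:
  fixes r s t :: real and V U :: "nat \<Rightarrow> real" and n m :: nat
  assumes "tribonacci_discriminant r s t > 0"
    and "generalized_tribonacci r s t V"
    and "U 0 = 0" and "U 1 = 1" and "U 2 = r"
    and "tribonacci_recurrence r s t U"
    and "m \<ge> 3"
  shows "tribonacci_octonion V (n + m) =
           U (m - 1) *\<^sub>R tribonacci_octonion V (n + 2)
           + (s * U (m - 2) + t * U (m - 3)) *\<^sub>R tribonacci_octonion V (n + 1)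
           + (t * U (m - 2)) *\<^sub>R tribonacci_octonion V n"
proof -
  have V: "tribonacci_recurrence r s t V"
    using assms(2) by (simp add: generalized_tribonacci_def)
  have "m = (m - 3) + 3" "m - 1 = (m - 3) + 2" "m - 2 = (m - 3) + 1"
    using \<open>m \<ge> 3\<close> by simp_all
  then show ?thesis
    using tribonacci_shift_formula[where W = "tribonacci_octonion V" and k = "m - 3" and n = n,
        OF tribonacci_octonion_recurrence[OF V] assms(6) assms(3-5)]
    by metis
qed

end
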